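(* Let $\pi^c\in\Pi$ and let $\pi_0\in\Phi(\pi^c)$. Let $\{x_t\}_{t\ge0}\subseteq X$ be the sequence of states visited and $\{\pi_t\}_{t\ge0}$ the sequence of policies generated by the asynchronous on-line algorithm described in the context, started at state $x_0\in X$ with policy $\pi_0$. Then for all $t\ge0$, $\pi_{t+1}$ is feasible, i.e. $\pi_{t+1}\in\Phi(\pi^c)$. Furthermore, the value functions of $\{\pi_t\}$ are monotonically and uniformly improving: $V^{\pi_{t+1}}(x)\ge V^{\pi_t}(x)$ for all $x\in X$ and all $t\ge0$.
   Context: $X$ is a finite state set and $A$ a finite action set; for each $x\in X$, $A(x)\subseteq A$ is the non-empty set of admissible actions at $x$. $P_{xy}^a$ is the probability of moving from $x$ to $y$ when action $a\in A(x)$ is taken at $x$ (so $P_{xy}^a\ge 0$, $\sum_{y\in X}P_{xy}^a=1$). $R$ and $C$ are real-valued functions on $\{(x,a): x\in X, a\in A(x)\}$ (reward and cost), and $\gamma,\beta\in(0,1)$ are discount factors. A policy is a map $\pi:X\to A$ with $\pi(x)\in A(x)$ for all $x$; $\Pi$ is the set of all policies. For $\pi\in\Pi$ and $x\in X$, $V^{\pi}(x)=E[\sum_{t=0}^{\infty}\gamma^tR(X_t,\pi(X_t))\mid X_0=x]$ and $J^{\pi}(x)=E[\sum_{t=0}^{\infty}\beta^tC(X_t,\pi(X_t))\mid X_0=x]$, where $(X_t)$ is the Markov chain with transition probabilities $P_{xy}^{\pi(x)}$. Inequalities between functions on $X$ are componentwise. $\Phi(\pi)=\{g\in\Pi: J^g\le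 J^{\pi}\}$. Asynchronous on-line algorithm: at each system time $t\ge0$, with current state $x_t$ and current policy $\pi_t$, set $$\alpha_{\pi_t}(x_t)=\Big\{a\in A(x_t)\ \Big|\ C(x_t,a)+\beta\sum_{y\in X}P_{x_ty}^aJ^{\pi_t}(y)\le J^{\pi_t}(x_t)\Big\}$$ (with the sets at states $x\ne x_t$ left unchanged). Then $\pi_{t+1}(x)=\pi_t(x)$ for $x\ne x_t$, and $$\pi_{t+1}(x_t)\in\operatorname{arg\,max}_{a\in\alpha_{\pi_t}(x_t)}\Big(R(x_t,a)+\gamma\sum_{y\in X}P_{x_ty}^aV^{\pi_t}(y)\Big).$$ Action $\pi_{t+1}(x_t)$ is then taken and the state makes a random transition from $x_t$ to $x_{t+1}$ (with probabilities $P_{x_ty}^{\pi_{t+1}(x_t)}$). The claim holds for every realization of the trajectory $\{x_t\}$. *)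

theory Defs
  imports "HOL-Probability.Probability"
begin

text \<open>
  The law of the trajectory \<open>(X\<^sub>t)\<close> of the Markov chain induced by the policy \<open>\<pi>\<close> and started at
  \<open>x\<close>, obtained from the Ionescu-Tulcea construction: coordinate \<open>0\<close> is \<open>x\<close>, and coordinate
  \<open>Suc t\<close> is drawn from \<open>P s (\<pi> s)\<close> where \<open>s\<close> is coordinate \<open>t\<close>.
\<close>

definition chain_kernel ::
  "('x \<Rightarrow> 'a \<Rightarrow> 'x pmf) \<Rightarrow> ('x \<Rightarrow> 'a) \<Rightarrow> 'x \<Rightarrow> nat \<Rightarrow> (nat \<Rightarrow> 'x) \<Rightarrow> 'x measure"
where
  "chain_kernel P \<pi> x n \<omega> =
     measure_pmf (case n of 0 \<Rightarrow> return_pmf x | Suc t \<Rightarrow> P (\<omega> t) (\<pi> (\<omega> t)))"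

definition chain_law ::
  "('x \<Rightarrow> 'a \<Rightarrow> 'x pmf) \<Rightarrow> ('x \<Rightarrow> 'a) \<Rightarrow> 'x \<Rightarrow> (nat \<Rightarrow> 'x) measure"
where
  "chain_law P \<pi> x =
     projective_family.lim UNIV
       (Ionescu_Tulcea.CI (chain_kernel P \<pi> x) (\<lambda>_. count_space UNIV))
       (\<lambda>_. count_space UNIV)"

lemma Ionescu_Tulcea_chain_kernel:
  fixes P :: "'x::finite \<Rightarrow> 'a \<Rightarrow> 'x pmf"
  shows "Ionescu_Tulcea (chain_kernel P \<pi> x) (\<lambda>_. count_space UNIV)"
proof (rule Ionescu_Tulcea.intro)
  show "chain_kernel P \<pi> x i \<in>
      measurable (PiM {0..<i} (\<lambda>_. count_space UNIV)) (subprob_algebra (count_space UNIV))" for i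
  proof (cases i)
    case 0
    then show ?thesis
      by (simp add: chain_kernel_def[abs_def] measure_pmf_in_subprob_algebra)
  next
    case (Suc t)
    have 1: "(\<lambda>\<omega>. \<omega> t) \<in> measurable (PiM {0..<i} (\<lambda>_. count_space UNIV :: 'x measure)) (count_space UNIV)"
      by (rule measurable_component_singleton) (simp add: Suc)
    have 2: "(\<lambda>s. measure_pmf (P s (\<pi> s))) \<in>
        measurable (count_space UNIV) (subprob_algebra (count_space UNIV))"
      by (simp add: measure_pmf_in_subprob_algebra)
    show ?thesis
      using measurable_compose[OF 1 2] by (simp add: chain_kernel_def[abs_def] Suc)
  qed
  show "prob_space (chain_kernel P \<pi> x i \<omega>)" for i \<omega>
    unfolding chain_kernel_def by (rule prob_space_measure_pmf)
qed

text \<open>The law is the intended one: its values on cylinders are the usual path probabilities.\<close>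

lemma emeasure_chain_law_cylinder:
  fixes P :: "'x::finite \<Rightarrow> 'a \<Rightarrow> 'x pmf"
  shows "emeasure (chain_law P \<pi> x) {\<omega>. \<forall>i\<le>n. \<omega> i = s i} =
    ennreal ((if s 0 = x then 1 else 0) * (\<Prod>i<n. pmf (P (s i) (\<pi> (s i))) (s (Suc i))))"
proof -
  interpret IT: Ionescu_Tulcea "chain_kernel P \<pi> x" "\<lambda>_. count_space UNIV"
    by (rule Ionescu_Tulcea_chain_kernel)
  let ?M = "\<lambda>_::nat. count_space (UNIV :: 'x set)"
  let ?S = "\<lambda>n. PiE {0..<n} (\<lambda>i. {s i})"
  have S: "?S n \<in> sets (PiM {0..<n} ?M)" for n
    by (rule sets_PiM_I_finite) auto
  have S_eq: "?S n = {restrict s {0..<n}}" for n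
  proof -
    have "?S n = PiE {0..<n} (\<lambda>i. {restrict s {0..<n} i})"
      by (rule PiE_cong) simp
    also have "\<dots> = {restrict s {0..<n}}"
      by (rule PiE_singleton) (rule restrict_extensional)
    finally show ?thesis .
  qed
  have C: "emeasure (IT.C 0 (Suc n) (\<lambda>x. undefined)) (?S (Suc n)) =
     ennreal ((if s 0 = x then 1 else 0) * (\<Prod>i<n. pmf (P (s i) (\<pi> (s i))) (s (Suc i))))" for n
  proof (induction n)
    have step: "emeasure (IT.C 0 (Suc n) (\<lambda>x. undefined)) (?S (Suc n)) =
      emeasure (IT.C 0 n (\<lambda>x. undefined)) (?S n) *
      emeasure (chain_kernel P \<pi> x n (restrict s {0..<n})) {s n}" for n
    proof -
      have sp: "(\<lambda>x. undefined) \<in> space (PiM {0..<0} ?M)"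
        by simp
      have ne: "space (IT.C 0 n (\<lambda>x. undefined)) \<noteq> {}"
        using prob_space.not_empty[OF IT.prob_space_C[OF sp, of n]] .
      have eq: "emeasure (IT.eP n \<omega>) (?S (Suc n)) =
          emeasure (chain_kernel P \<pi> x n (restrict s {0..<n})) {s n} * indicator (?S n) \<omega>"
        if "\<omega> \<in> space (PiM {0..<n} ?M)" for \<omega>
      proof -
        have ext: "\<omega> \<in> extensional {0..<n}"
          using that by (simp add: space_PiM PiE_def)
        have "fun_upd \<omega> n -` ?S (Suc n) = (if \<omega> \<in> ?S n then {s n} else {})"
          using ext by (auto simp: PiE_iff extensional_def less_Suc_eq split: if_splits)
        then show ?thesis
          using that S_eq[of n] by (auto simp: IT.emeasure_eP S indicator_def)
      qed
      have "emeasure (IT.C 0 (Suc n) (\<lambda>x. undefined)) (?S (Suc n)) =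
        (\<integral>\<^sup>+\<omega>. emeasure (IT.eP n \<omega>) (?S (Suc n)) \<partial>IT.C 0 n (\<lambda>x. undefined))"
        using emeasure_bind[OF ne, of "IT.eP n" "PiM {0..<Suc n} ?M" "?S (Suc n)"]
          IT.sets_C[OF sp, of n] S[of "Suc n"] IT.measurable_eP[of n]
        by (simp cong: measurable_cong_sets)
      also have "\<dots> = (\<integral>\<^sup>+\<omega>. emeasure (chain_kernel P \<pi> x n (restrict s {0..<n})) {s n} *
          indicator (?S n) \<omega> \<partial>IT.C 0 n (\<lambda>x. undefined))"
        using IT.space_C[OF sp, of n] by (intro nn_integral_cong eq) simp
      also have "\<dots> = emeasure (IT.C 0 n (\<lambda>x. undefined)) (?S n) *
          emeasure (chain_kernel P \<pi> x n (restrict s {0..<n})) {s n}"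
        using IT.sets_C[OF sp, of n] S[of n] by (subst nn_integral_cmult_indicator) (simp_all add: mult.commute)
      finally show ?thesis .
    qed
    case 0
    show ?case
      unfolding step[of 0] using S[of 0]
      by (simp add: chain_kernel_def emeasure_pmf_single pmf_return)
    case (Suc n)
    have "emeasure (chain_kernel P \<pi> x (Suc n) (restrict s {0..<Suc n})) {s (Suc n)} =
        ennreal (pmf (P (s n) (\<pi> (s n))) (s (Suc n)))"
      by (simp add: chain_kernel_def emeasure_pmf_single)
    then show ?case
      unfolding step[of "Suc n"] Suc
      by (simp add: ennreal_mult prod_nonneg)
  qed
  have "{\<omega>. \<forall>i\<le>n. \<omega> i = s i} = prod_emb UNIV ?M {0..<Suc n} (?S (Suc n))"
    by (auto simp: prod_emb_def space_PiM PiE_iff less_Suc_eq_le)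
  then have "emeasure (chain_law P \<pi> x) {\<omega>. \<forall>i\<le>n. \<omega> i = s i} =
      emeasure (IT.CI {0..<Suc n}) (?S (Suc n))"
    unfolding chain_law_def using IT.lim[OF _ S[of "Suc n"]] by simp
  also have "\<dots> = emeasure (IT.C 0 (Suc n) (\<lambda>x. undefined)) (?S (Suc n))"
    using S[of "Suc n"] by (subst IT.emeasure_CI[OF order_refl]) auto
  finally show ?thesis
    unfolding C .
qed

definition discounted_value ::
  "('x::finite \<Rightarrow> 'a \<Rightarrow> 'x pmf) \<Rightarrow> real \<Rightarrow> ('x \<Rightarrow> 'a \<Rightarrow> real) \<Rightarrow> ('x \<Rightarrow> 'a) \<Rightarrow> 'x \<Rightarrow> real"
where
  "discounted_value P \<delta> f \<pi> x = (\<integral>\<omega>. (\<Sum>t. \<delta> ^ t * f (\<omega> t) (\<pi> (\<omega> t))) \<partial>chain_law P \<pi> x)"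

definition lookahead ::
  "('x::finite \<Rightarrow> 'a \<Rightarrow> 'x pmf) \<Rightarrow> real \<Rightarrow> ('x \<Rightarrow> 'a \<Rightarrow> real) \<Rightarrow> ('x \<Rightarrow> real) \<Rightarrow> 'x \<Rightarrow> 'a \<Rightarrow> real"
where
  "lookahead P \<delta> f v x a = f x a + \<delta> * (\<Sum>y\<in>UNIV. pmf (P x a) y * v y)"

definition policies :: "('x \<Rightarrow> 'a set) \<Rightarrow> ('x \<Rightarrow> 'a) set"
where
  "policies A = {\<pi>. \<forall>x. \<pi> x \<in> A x}"

definition feasible_policies ::
  "('x::finite \<Rightarrow> 'a set) \<Rightarrow> ('x \<Rightarrow> 'a \<Rightarrow> 'x pmf) \<Rightarrow> real \<Rightarrow> ('x \<Rightarrow> 'a \<Rightarrow> real) \<Rightarrow>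
   ('x \<Rightarrow> 'a) \<Rightarrow> ('x \<Rightarrow> 'a) set"
where
  "feasible_policies A P \<beta> C \<pi> =
     {g \<in> policies A. \<forall>x. discounted_value P \<beta> C g x \<le> discounted_value P \<beta> C \<pi> x}"

definition safe_actions ::
  "('x::finite \<Rightarrow> 'a set) \<Rightarrow> ('x \<Rightarrow> 'a \<Rightarrow> 'x pmf) \<Rightarrow> real \<Rightarrow> ('x \<Rightarrow> 'a \<Rightarrow> real) \<Rightarrow>
   ('x \<Rightarrow> 'a) \<Rightarrow> 'x \<Rightarrow> 'a set"
where
  "safe_actions A P \<beta> C \<pi> x =
     {a \<in> A x. lookahead P \<beta> C (discounted_value P \<beta> C \<pi>) x a \<le> discounted_value P \<beta> C \<pi> x}"

text \<open>
  A realization \<open>(x\<^sub>t, \<pi>\<^sub>t)\<close> of the asynchronous on-line algorithm. The random transition is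
  rendered pathwise: \<open>x\<^sub>t\<^sub>+\<^sub>1\<close> is any state of positive probability.
\<close>

definition online_run ::
  "('x::finite \<Rightarrow> 'a set) \<Rightarrow> ('x \<Rightarrow> 'a \<Rightarrow> 'x pmf) \<Rightarrow> real \<Rightarrow> real \<Rightarrow>
   ('x \<Rightarrow> 'a \<Rightarrow> real) \<Rightarrow> ('x \<Rightarrow> 'a \<Rightarrow> real) \<Rightarrow> (nat \<Rightarrow> 'x) \<Rightarrow> (nat \<Rightarrow> 'x \<Rightarrow> 'a) \<Rightarrow> bool"
where
  "online_run A P \<gamma> \<beta> R C x \<pi> \<longleftrightarrow>
     (\<forall>t. (\<forall>y. y \<noteq> x t \<longrightarrow> \<pi> (Suc t) y = \<pi> t y) \<and>
          is_arg_max (lookahead P \<gamma> R (discounted_value P \<gamma> R (\<pi> t)) (x t))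
            (\<lambda>a. a \<in> safe_actions A P \<beta> C (\<pi> t) (x t)) (\<pi> (Suc t) (x t)) \<and>
          x (Suc t) \<in> set_pmf (P (x t) (\<pi> (Suc t) (x t))))"

end

theory Submission
  imports Defs
begin

text \<open>
  Conditioning on the first transition shows that a discounted value function is a fixed point of
  the affine operator \<open>v \<mapsto> lookahead v\<close> of its policy. This operator is monotone
  and contracts by the discount factor, so a function which it does not decrease (increase) lies
  below (above) the value function. The old policy's own action is always safe, hence its
  value functions are such sub- and supersolutions for the new policy.
\<close>

section \<open>Measurability and total mass of the trajectory law\<close>

lemma sets_chain_law:
  fixes P :: "'x::finite \<Rightarrow> 'a \<Rightarrow> 'x pmf"
  shows "sets (chain_law P \<pi> x) = sets (PiM UNIV (\<lambda>_. count_space UNIV))"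
proof -
  interpret IT: Ionescu_Tulcea "chain_kernel P \<pi> x" "\<lambda>_. count_space UNIV"
    by (rule Ionescu_Tulcea_chain_kernel)
  show ?thesis
    unfolding chain_law_def by simp
qed

lemma space_chain_law:
  fixes P :: "'x::finite \<Rightarrow> 'a \<Rightarrow> 'x pmf"
  shows "space (chain_law P \<pi> x) = UNIV"
  using sets_eq_imp_space_eq[OF sets_chain_law] by (simp add: space_PiM)

lemma measurable_coordinate_chain_law [measurable]:
  fixes P :: "'x::finite \<Rightarrow> 'a \<Rightarrow> 'x pmf"
  shows "(\<lambda>\<omega>. \<omega> n) \<in> measurable (chain_law P \<pi> x) (count_space UNIV)"
  by (simp add: measurable_cong_sets[OF sets_chain_law refl])

lemma measure_chain_law_cylinder:
  fixes P :: "'x::finite \<Rightarrow> 'a \<Rightarrow> 'x pmf"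
  shows "measure (chain_law P \<pi> x) {\<omega>. \<forall>i\<le>n. \<omega> i = s i} =
    (if s 0 = x then 1 else 0) * (\<Prod>i<n. pmf (P (s i) (\<pi> (s i))) (s (Suc i)))"
  unfolding measure_def emeasure_chain_law_cylinder
  by (rule enn2real_ennreal) (simp add: prod_nonneg)

lemma cylinder_in_sets_chain_law:
  fixes P :: "'x::finite \<Rightarrow> 'a \<Rightarrow> 'x pmf"
  shows "{\<omega>. \<forall>i\<le>n. \<omega> i = s i} \<in> sets (chain_law P \<pi> x)"
proof -
  have "{\<omega> \<in> space (chain_law P \<pi> x). \<forall>i\<in>{..n}. \<omega> i = s i} \<in> sets (chain_law P \<pi> x)"
    by measurable
  then show ?thesis
    by (simp add: space_chain_law Ball_def)
qed

text \<open>The cylinders prescribing coordinate \<open>0\<close> partition the path space, and only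
  the one at \<open>x\<close> carries mass.\<close>

lemma prob_space_chain_law:
  fixes P :: "'x::finite \<Rightarrow> 'a \<Rightarrow> 'x pmf"
  shows "prob_space (chain_law P \<pi> x)"
proof
  have cyl: "{\<omega>. \<forall>i\<le>0. \<omega> i = z} \<in> sets (chain_law P \<pi> x)" for z
    by (rule cylinder_in_sets_chain_law)
  have "emeasure (chain_law P \<pi> x) (\<Union>z\<in>UNIV. {\<omega>. \<forall>i\<le>0. \<omega> i = z}) =
      (\<Sum>z\<in>UNIV. emeasure (chain_law P \<pi> x) {\<omega>. \<forall>i\<le>0. \<omega> i = z})"
    by (intro sum_emeasure[symmetric])
      (use cyl in \<open>auto simp: disjoint_family_on_def\<close>)
  also have "\<dots> = (\<Sum>z\<in>UNIV. if z = x then 1 else 0)"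
    by (intro sum.cong refl) (subst emeasure_chain_law_cylinder, simp)
  also have "\<dots> = 1"
    by simp
  also have "(\<Union>z\<in>UNIV. {\<omega>. \<forall>i\<le>0. \<omega> i = z}) = space (chain_law P \<pi> x)"
    by (auto simp: space_chain_law)
  finally show "emeasure (chain_law P \<pi> x) (space (chain_law P \<pi> x)) = 1" .
qed

lemma finite_measure_chain_law:
  fixes P :: "'x::finite \<Rightarrow> 'a \<Rightarrow> 'x pmf"
  shows "finite_measure (chain_law P \<pi> x)"
  using prob_space_chain_law by (rule prob_space.finite_measure)

section \<open>Expectations of single coordinates and the Markov property\<close>

text \<open>The \<open>j\<close>-th power of the transition matrix of \<open>\<pi>\<close>, applied
  to \<open>h\<close>. The recursion peels off the first transition, as the Bellman equation
  requires.\<close>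

fun expected_at :: "('x::finite \<Rightarrow> 'a \<Rightarrow> 'x pmf) \<Rightarrow> ('x \<Rightarrow> 'a) \<Rightarrow> ('x \<Rightarrow> real) \<Rightarrow> nat \<Rightarrow> 'x \<Rightarrow> real"
where
  "expected_at P \<pi> h 0 x = h x"
| "expected_at P \<pi> h (Suc j) x = (\<Sum>z\<in>UNIV. pmf (P x (\<pi> x)) z * expected_at P \<pi> h j z)"

text \<open>Averaging with weights of total mass one does not increase the sup norm. The bound is
  uniform in \<open>j\<close>, so discounting makes the series converge.\<close>

lemma abs_expected_at_le:
  assumes "\<And>z. \<bar>h z\<bar> \<le> B"
  shows "\<bar>expected_at P \<pi> h j x\<bar> \<le> B"
proof (induction j arbitrary: x)
  case 0
  then show ?case using assms by simp
next
  case (Suc j)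
  have "\<bar>expected_at P \<pi> h (Suc j) x\<bar> \<le> (\<Sum>z\<in>UNIV. pmf (P x (\<pi> x)) z * B)"
    unfolding expected_at.simps
    by (rule order_trans[OF sum_abs])
      (intro sum_mono, auto simp: abs_mult intro!: mult_left_mono Suc)
  also have "\<dots> = B"
    by (simp add: sum_distrib_right[symmetric] sum_pmf_eq_1)
  finally show ?case .
qed

lemma finite_domain_abs_bound:
  fixes h :: "'x::finite \<Rightarrow> real"
  shows "\<exists>B. \<forall>z. \<bar>h z\<bar> \<le> B"
proof (intro exI allI)
  show "\<bar>h z\<bar> \<le> (\<Sum>y\<in>UNIV. \<bar>h y\<bar>)" for z
    by (rule member_le_sum) auto
qed

lemma integrable_coordinate_indicator_chain_law:
  fixes P :: "'x::finite \<Rightarrow> 'a \<Rightarrow> 'x pmf" and h :: "'x \<Rightarrow> real"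
  assumes "S \<in> sets (chain_law P \<pi> x)"
  shows "integrable (chain_law P \<pi> x) (\<lambda>\<omega>. h (\<omega> n) * indicator S \<omega>)"
proof -
  obtain B where B: "\<And>z. \<bar>h z\<bar> \<le> B"
    using finite_domain_abs_bound[of h] by blast
  have "h \<in> measurable (count_space UNIV) borel"
    by simp
  note [measurable] = this assms
  \<comment> \<open>Where the indicator vanishes, the required bound reads \<open>0 \<le> B\<close>;
    any state supplies it.\<close>
  have "0 \<le> B"
    using B[of undefined] by linarith
  then show ?thesis
    by (intro finite_measure.integrable_const_bound[OF finite_measure_chain_law, of _ B])
      (auto simp: abs_mult indicator_def B)
qed

text \<open>Prescribing one more coordinate at a time turns the cylinder formula into the Markov property.\<close>

lemma integral_coordinate_on_cylinder:
  fixes P :: "'x::finite \<Rightarrow> 'a \<Rightarrow> 'x pmf" and h :: "'x \<Rightarrow> real"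
  shows "(\<integral>\<omega>. h (\<omega> (k + j)) * indicator {\<omega>. \<forall>i\<le>k. \<omega> i = s i} \<omega> \<partial>chain_law P \<pi> x) =
    measure (chain_law P \<pi> x) {\<omega>. \<forall>i\<le>k. \<omega> i = s i} * expected_at P \<pi> h j (s k)"
\<comment> \<open>The step applies the hypothesis with \<open>Suc k\<close> and with
  \<open>s\<close> altered at \<open>Suc k\<close>.\<close>
proof (induction j arbitrary: k s)
  case 0
  have "(\<integral>\<omega>. h (\<omega> (k + 0)) * indicator {\<omega>. \<forall>i\<le>k. \<omega> i = s i} \<omega> \<partial>chain_law P \<pi> x) =
      (\<integral>\<omega>. h (s k) * indicator {\<omega>. \<forall>i\<le>k. \<omega> i = s i} \<omega> \<partial>chain_law P \<pi> x)"
    by (intro Bochner_Integration.integral_cong refl) (auto simp: indicator_def)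
  then show ?case
    by (simp add: space_chain_law)
next
  case (Suc j)
  let ?cyl = "\<lambda>k s. {\<omega>::nat \<Rightarrow> 'x. \<forall>i\<le>k. \<omega> i = s i}"
  let ?s = "\<lambda>z. s(Suc k := z)"
  \<comment> \<open>The cylinder is the disjoint union over the value \<open>z\<close> of the next
    coordinate; on a given path only \<open>z = \<omega> (Suc k)\<close> contributes.\<close>
  have split: "indicator (?cyl k s) \<omega> = (\<Sum>z\<in>UNIV. indicator (?cyl (Suc k) (?s z)) \<omega> :: real)" for \<omega>
  proof -
    have "indicator (?cyl (Suc k) (?s z)) \<omega> =
        (if z = \<omega> (Suc k) then indicator (?cyl k s) \<omega> else 0 :: real)" for z
      by (auto simp: indicator_def le_Suc_eq)
    then show ?thesis
      by simp
  qed
  \<comment> \<open>Altering \<open>s\<close> at \<open>Suc k\<close> keeps the first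
    \<open>k\<close> factors of the cylinder product; the new factor is the transition to
    \<open>z\<close>.\<close>
  have weight: "measure (chain_law P \<pi> x) (?cyl (Suc k) (?s z)) =
      measure (chain_law P \<pi> x) (?cyl k s) * pmf (P (s k) (\<pi> (s k))) z" for z
    unfolding measure_chain_law_cylinder by simp
  have "(\<integral>\<omega>. h (\<omega> (k + Suc j)) * indicator (?cyl k s) \<omega> \<partial>chain_law P \<pi> x) =
      (\<Sum>z\<in>UNIV. \<integral>\<omega>. h (\<omega> (Suc k + j)) * indicator (?cyl (Suc k) (?s z)) \<omega> \<partial>chain_law P \<pi> x)"
    unfolding split sum_distrib_left add_Suc_right add_Suc
    by (intro Bochner_Integration.integral_sum integrable_coordinate_indicator_chain_law
        cylinder_in_sets_chain_law)
  also have "\<dots> = (\<Sum>z\<in>UNIV. measure (chain_law P \<pi> x) (?cyl (Suc k) (?s z)) *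
      expected_at P \<pi> h j (?s z (Suc k)))"
    unfolding Suc.IH ..
  also have "\<dots> = measure (chain_law P \<pi> x) (?cyl k s) * expected_at P \<pi> h (Suc j) (s k)"
    unfolding weight by (simp add: sum_distrib_left mult.assoc)
  finally show ?case .
qed

text \<open>Summing the case \<open>k = 0\<close> of the cylinder formula over all initial values
  leaves only the term at \<open>x\<close>.\<close>

lemma integral_coordinate_chain_law:
  fixes P :: "'x::finite \<Rightarrow> 'a \<Rightarrow> 'x pmf" and h :: "'x \<Rightarrow> real"
  shows "(\<integral>\<omega>. h (\<omega> j) \<partial>chain_law P \<pi> x) = expected_at P \<pi> h j x"
proof -
  let ?cyl = "\<lambda>z. {\<omega>::nat \<Rightarrow> 'x. \<forall>i\<le>0. \<omega> i = z}"
  have cyl: "(\<integral>\<omega>. h (\<omega> (0 + j)) * indicator (?cyl z) \<omega> \<partial>chain_law P \<pi> x) =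
      (if z = x then 1 else 0) * expected_at P \<pi> h j z" for z
    using integral_coordinate_on_cylinder[of P \<pi> x h 0 j "\<lambda>_. z"]
      measure_chain_law_cylinder[of P \<pi> x 0 "\<lambda>_. z"] by simp
  have split: "h (\<omega> j) = (\<Sum>z\<in>UNIV. h (\<omega> (0 + j)) * indicator (?cyl z) \<omega>)" for \<omega>
    by (simp add: indicator_def if_distrib cong: if_cong)
  have "(\<integral>\<omega>. h (\<omega> j) \<partial>chain_law P \<pi> x) =
      (\<Sum>z\<in>UNIV. \<integral>\<omega>. h (\<omega> (0 + j)) * indicator (?cyl z) \<omega> \<partial>chain_law P \<pi> x)"
    by (subst split, intro Bochner_Integration.integral_sum
        integrable_coordinate_indicator_chain_law cylinder_in_sets_chain_law)
  also have "\<dots> = (\<Sum>z\<in>UNIV. (if z = x then 1 else 0) * expected_at P \<pi> h j z)"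
    by (simp only: cyl)
  also have "\<dots> = expected_at P \<pi> h j x"
    by (simp add: if_distrib if_distribR cong: if_cong)
  finally show ?thesis .
qed

section \<open>Discounted series and the Bellman equation\<close>

lemma summable_discounted:
  fixes u :: "nat \<Rightarrow> real"
  assumes "0 \<le> \<delta>" "\<delta> < 1" and "\<And>t. \<bar>u t\<bar> \<le> B"
  shows "summable (\<lambda>t. \<delta> ^ t * u t)"
proof (rule summable_comparison_test')
  show "summable (\<lambda>t. \<delta> ^ t * B)"
    using assms by (intro summable_mult2 summable_geometric) auto
  show "norm (\<delta> ^ t * u t) \<le> \<delta> ^ t * B" for t
    using assms by (simp add: abs_mult mult_left_mono)
qed

text \<open>Payoffs on a finite state space are bounded, so the absolute series has finite
  expectation and integral and sum may be exchanged. This replaces path integrals by numerical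
  series.\<close>

lemma discounted_value_eq_suminf:
  fixes P :: "'x::finite \<Rightarrow> 'a \<Rightarrow> 'x pmf"
  assumes \<delta>: "0 \<le> \<delta>" "\<delta> < 1"
  shows "discounted_value P \<delta> f \<pi> x =
    (\<Sum>t. \<delta> ^ t * expected_at P \<pi> (\<lambda>z. f z (\<pi> z)) t x)"
proof -
  let ?h = "\<lambda>z. f z (\<pi> z)"
  let ?M = "chain_law P \<pi> x"
  obtain B where B: "\<And>z. \<bar>?h z\<bar> \<le> B"
    using finite_domain_abs_bound[of ?h] by blast
  have int: "integrable ?M (\<lambda>\<omega>. k (\<omega> t))" for k :: "'x \<Rightarrow> real" and t
    using integrable_coordinate_indicator_chain_law[of UNIV P \<pi> x k t] sets.top[of ?M]
    by (simp add: space_chain_law)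
  have "discounted_value P \<delta> f \<pi> x = (\<Sum>t. \<integral>\<omega>. \<delta> ^ t * ?h (\<omega> t) \<partial>?M)"
    unfolding discounted_value_def
  proof (rule integral_suminf)
    show "integrable ?M (\<lambda>\<omega>. \<delta> ^ t * ?h (\<omega> t))" for t
      by (rule int)
    \<comment> \<open>\<open>B\<close> bounds the payoff along every path, so convergence is in fact
      sure; the underscore leaves the path open.\<close>
    show "AE \<omega> in ?M. summable (\<lambda>t. norm (\<delta> ^ t * ?h (\<omega> t)))"
      using summable_discounted[OF \<delta>, of "\<lambda>t. \<bar>?h (_ t)\<bar>" B] \<delta> B by (simp add: abs_mult)
    have "(\<integral>\<omega>. norm (\<delta> ^ t * ?h (\<omega> t)) \<partial>?M) =
        \<delta> ^ t * expected_at P \<pi> (\<lambda>z. \<bar>?h z\<bar>) t x" for t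
      using \<delta> integral_coordinate_chain_law[of P \<pi> x "\<lambda>z. \<bar>?h z\<bar>" t] by (simp add: abs_mult)
    then show "summable (\<lambda>t. \<integral>\<omega>. norm (\<delta> ^ t * ?h (\<omega> t)) \<partial>?M)"
      using summable_discounted[OF \<delta> abs_expected_at_le[where h = "\<lambda>z. \<bar>?h z\<bar>" and B = B]] B by simp
  qed
  then show ?thesis
    using integral_coordinate_chain_law[of P \<pi> x ?h] by simp
qed

text \<open>The Bellman equation of a fixed policy: the term at time \<open>0\<close> is the
  immediate payoff, and each later term splits off one factor \<open>\<delta>\<close> and an average
  over the first transition.\<close>

lemma discounted_value_fixed_point:
  fixes P :: "'x::finite \<Rightarrow> 'a \<Rightarrow> 'x pmf"
  assumes \<delta>: "0 \<le> \<delta>" "\<delta> < 1"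
  shows "discounted_value P \<delta> f \<pi> x = lookahead P \<delta> f (discounted_value P \<delta> f \<pi>) x (\<pi> x)"
proof -
  let ?h = "\<lambda>z. f z (\<pi> z)"
  let ?e = "expected_at P \<pi> ?h"
  let ?p = "pmf (P x (\<pi> x))"
  obtain B where "\<And>z. \<bar>?h z\<bar> \<le> B"
    using finite_domain_abs_bound[of ?h] by blast
  then have summ: "summable (\<lambda>t. \<delta> ^ t * ?e t z)" for z
    by (intro summable_discounted[OF \<delta>] abs_expected_at_le)
  have "discounted_value P \<delta> f \<pi> x = ?h x + (\<Sum>t. \<delta> ^ Suc t * ?e (Suc t) x)"
    unfolding discounted_value_eq_suminf[OF \<delta>] using suminf_split_head[OF summ[of x]] by simp
  also have "(\<Sum>t. \<delta> ^ Suc t * ?e (Suc t) x) = (\<Sum>t. \<Sum>z\<in>UNIV. \<delta> * ?p z * (\<delta> ^ t * ?e t z))"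
    by (simp add: sum_distrib_left mult_ac)
  \<comment> \<open>The sum over successors is finite, so summability at each \<open>z\<close>
    suffices for the exchange.\<close>
  also have "\<dots> = (\<Sum>z\<in>UNIV. \<Sum>t. \<delta> * ?p z * (\<delta> ^ t * ?e t z))"
    by (intro suminf_sum summable_mult summ)
  also have "\<dots> = (\<Sum>z\<in>UNIV. \<delta> * ?p z * discounted_value P \<delta> f \<pi> z)"
    unfolding discounted_value_eq_suminf[OF \<delta>] by (intro sum.cong refl suminf_mult summ)
  finally show ?thesis
    unfolding lookahead_def by (simp add: sum_distrib_left mult.assoc)
qed

section \<open>Comparison with sub- and supersolutions\<close>

text \<open>At a minimizer \<open>m\<close> of \<open>w\<close> the hypothesis gives \<open>w m \<ge> \<delta> * w m\<close>.\<close>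

lemma nonneg_if_ge_discounted_mean:
  fixes w :: "'x::finite \<Rightarrow> real" and q :: "'x \<Rightarrow> 'x pmf"
  assumes \<delta>: "0 \<le> \<delta>" "\<delta> < 1" and w: "\<And>x. \<delta> * (\<Sum>y\<in>UNIV. pmf (q x) y * w y) \<le> w x"
  shows "0 \<le> w x"
proof -
  have "Min (range w) \<in> range w"
    by (rule Min_in) auto
  then obtain m where m: "w m = Min (range w)"
    by (metis rangeE)
  have min: "w m \<le> w y" for y
    unfolding m by (rule Min_le) auto
  have "w m = (\<Sum>y\<in>UNIV. pmf (q m) y * w m)"
    by (simp add: sum_distrib_right[symmetric] sum_pmf_eq_1)
  also have "\<dots> \<le> (\<Sum>y\<in>UNIV. pmf (q m) y * w y)"
    by (intro sum_mono mult_left_mono min) simp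
  finally have "\<delta> * w m \<le> w m"
    using w[of m] mult_left_mono[OF _ \<delta>(1)] by (meson order_trans)
  \<comment> \<open>Here \<open>\<delta> < 1\<close> matters: cancelling \<open>1 - \<delta>\<close>
    gives the sign at \<open>m\<close>, and minimality carries it to every state.\<close>
  then have "0 \<le> (1 - \<delta>) * w m"
    by (simp add: algebra_simps)
  then show ?thesis
    using \<delta> min[of x] by (simp add: zero_le_mult_iff)
qed

lemma lookahead_diff:
  "lookahead P \<delta> f u x a - lookahead P \<delta> f v x a =
    \<delta> * (\<Sum>y\<in>UNIV. pmf (P x a) y * (u y - v y))"
  unfolding lookahead_def by (simp add: sum_subtractf right_diff_distrib)

text \<open>Subtracting the hypothesis from the Bellman equation cancels the payoff: the value
  function minus \<open>v\<close> dominates its own discounted mean, hence is nonnegative. No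
  iteration or limit is involved.\<close>

lemma subsolution_le_discounted_value:
  fixes P :: "'x::finite \<Rightarrow> 'a \<Rightarrow> 'x pmf"
  assumes \<delta>: "0 \<le> \<delta>" "\<delta> < 1" and v: "\<And>x. v x \<le> lookahead P \<delta> f v x (g x)"
  shows "v x \<le> discounted_value P \<delta> f g x"
proof -
  let ?w = "\<lambda>y. discounted_value P \<delta> f g y - v y"
  have "\<delta> * (\<Sum>y\<in>UNIV. pmf (P z (g z)) y * ?w y) \<le> ?w z" for z
    using discounted_value_fixed_point[OF \<delta>, of P f g z] v[of z]
    unfolding lookahead_diff[where f = f, symmetric] by linarith
  from nonneg_if_ge_discounted_mean[OF \<delta> this] show ?thesis
    by simp
qed

lemma discounted_value_le_supersolution:
  fixes P :: "'x::finite \<Rightarrow> 'a \<Rightarrow> 'x pmf"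
  assumes \<delta>: "0 \<le> \<delta>" "\<delta> < 1" and v: "\<And>x. lookahead P \<delta> f v x (g x) \<le> v x"
  shows "discounted_value P \<delta> f g x \<le> v x"
proof -
  let ?w = "\<lambda>y. v y - discounted_value P \<delta> f g y"
  have "\<delta> * (\<Sum>y\<in>UNIV. pmf (P z (g z)) y * ?w y) \<le> ?w z" for z
    using discounted_value_fixed_point[OF \<delta>, of P f g z] v[of z]
    unfolding lookahead_diff[where f = f, symmetric] by linarith
  from nonneg_if_ge_discounted_mean[OF \<delta> this] show ?thesis
    by simp
qed

section \<open>Policy improvement under the cost constraint\<close>

text \<open>By the Bellman equation the constraint holds with equality at the policy's own action,
  which therefore competes in every greedy choice.\<close>

lemma policy_action_safe:
  assumes "0 \<le> \<beta>" "\<beta> < 1" "\<pi> \<in> policies A"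
  shows "\<pi> x \<in> safe_actions A P \<beta> C \<pi> x"
  using assms discounted_value_fixed_point[of \<beta> P C \<pi> x]
  by (simp add: safe_actions_def policies_def)

text \<open>Safety of all actions of \<open>g\<close> makes the cost function of
  \<open>\<pi>\<close> a supersolution for \<open>g\<close>. The switch may change any number of
  states at once.\<close>

lemma safe_switch_feasible:
  assumes \<beta>: "0 \<le> \<beta>" "\<beta> < 1" and "\<pi> \<in> feasible_policies A P \<beta> C \<pi>c"
    and g: "\<And>x. g x \<in> safe_actions A P \<beta> C \<pi> x"
  shows "g \<in> feasible_policies A P \<beta> C \<pi>c"
proof -
  have "discounted_value P \<beta> C g x \<le> discounted_value P \<beta> C \<pi> x" for x
    using g by (intro discounted_value_le_supersolution[OF \<beta>]) (simp add: safe_actions_def)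
  moreover have "discounted_value P \<beta> C \<pi> x \<le> discounted_value P \<beta> C \<pi>c x" for x
    using assms(3) by (simp add: feasible_policies_def)
  ultimately have "discounted_value P \<beta> C g x \<le> discounted_value P \<beta> C \<pi>c x" for x
    by (rule order_trans)
  then show ?thesis
    using g by (simp add: feasible_policies_def policies_def safe_actions_def)
qed

theorem mainTheorem6:
  fixes A :: "'x::finite \<Rightarrow> 'a::finite set"
    and P :: "'x \<Rightarrow> 'a \<Rightarrow> 'x pmf"
    and R C :: "'x \<Rightarrow> 'a \<Rightarrow> real"
    and \<gamma> \<beta> :: real
    and \<pi>c :: "'x \<Rightarrow> 'a"
    and x :: "nat \<Rightarrow> 'x"
    and \<pi> :: "nat \<Rightarrow> 'x \<Rightarrow> 'a"
  assumes "\<And>s. A s \<noteq> {}"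
    and "0 < \<gamma>" "\<gamma> < 1" "0 < \<beta>" "\<beta> < 1"
    and "\<pi>c \<in> policies A"
    and "\<pi> 0 \<in> feasible_policies A P \<beta> C \<pi>c"
    and "online_run A P \<gamma> \<beta> R C x \<pi>"
  shows "(\<forall>t. \<pi> (Suc t) \<in> feasible_policies A P \<beta> C \<pi>c) \<and>
    (\<forall>t s. discounted_value P \<gamma> R (\<pi> (Suc t)) s \<ge> discounted_value P \<gamma> R (\<pi> t) s)"
proof -
  have \<gamma>: "0 \<le> \<gamma>" "\<gamma> < 1" and \<beta>: "0 \<le> \<beta>" "\<beta> < 1"
    using assms by auto
  have unchanged: "\<pi> (Suc t) y = \<pi> t y" if "y \<noteq> x t" for t y
    using assms(8) that by (simp add: online_run_def)
  have greedy: "is_arg_max (lookahead P \<gamma> R (discounted_value P \<gamma> R (\<pi> t)) (x t))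
      (\<lambda>a. a \<in> safe_actions A P \<beta> C (\<pi> t) (x t)) (\<pi> (Suc t) (x t))" for t
    using assms(8) by (simp add: online_run_def)
  have safe: "\<pi> t y \<in> safe_actions A P \<beta> C (\<pi> t) y"
    if "\<pi> t \<in> feasible_policies A P \<beta> C \<pi>c" for t y
    using that by (intro policy_action_safe[OF \<beta>]) (simp add: feasible_policies_def)
  \<comment> \<open>The induction starts at \<open>0\<close>, one index before the claim, since
    safety of the old actions needs \<open>\<pi> t\<close> itself to be feasible.\<close>
  have feasible: "\<pi> t \<in> feasible_policies A P \<beta> C \<pi>c" for t
  proof (induction t)
    case 0
    show ?case by (rule assms(7))
  next
    case (Suc t)
    \<comment> \<open>At \<open>x t\<close> the greedy action is chosen among the safe ones;
      elsewhere the old action stays.\<close>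
    have "\<pi> (Suc t) y \<in> safe_actions A P \<beta> C (\<pi> t) y" for y
      using greedy[of t] unchanged[of y t] safe[OF Suc, of y]
      by (cases "y = x t") (auto simp: is_arg_max_def)
    then show ?case
      by (rule safe_switch_feasible[OF \<beta> Suc])
  qed
  have "discounted_value P \<gamma> R (\<pi> t) s \<le> discounted_value P \<gamma> R (\<pi> (Suc t)) s" for t s
  proof (rule subsolution_le_discounted_value[OF \<gamma>])
    let ?V = "discounted_value P \<gamma> R (\<pi> t)"
    fix y
    \<comment> \<open>At \<open>x t\<close> the old action is a safe competitor of the maximizer; at
      other states both sides coincide.\<close>
    have "lookahead P \<gamma> R ?V y (\<pi> t y) \<le> lookahead P \<gamma> R ?V y (\<pi> (Suc t) y)"
      using greedy[of t] unchanged[of y t] safe[OF feasible[of t], of y]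
      by (cases "y = x t") (auto simp: is_arg_max_def not_less)
    \<comment> \<open>The lookahead of \<open>?V\<close> at the old policy's own action is
      \<open>?V y\<close> itself.\<close>
    then show "?V y \<le> lookahead P \<gamma> R ?V y (\<pi> (Suc t) y)"
      unfolding discounted_value_fixed_point[OF \<gamma>, of P R "\<pi> t" y, symmetric] .
  qed
  with feasible show ?thesis
    by blast
qed

end
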